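(* Let $\ell:\mathbb{R}^{n\times m}\to\mathbb{R}$ be twice differentiable, $K$-smooth and $\mu$-strongly convex with $\min_W \ell(W)=0$, let $h\ge \min\{n,m\}$, and let $L(W_1,W_2)=\ell(W_1W_2^\top)$ for $W_1\in\mathbb{R}^{n\times h}$, $W_2\in\mathbb{R}^{m\times h}$. Consider gradient descent on $L$ with step sizes $\eta_t>0$. At the $t$-th iteration, put $$\mu_t=\mu\,\sigma_{\min}^2(\mathcal{T}_t),$$ $$K_t = K\sigma_{\max}^2(\mathcal{T}_t)+\sqrt{2KL(t)}+6K^2\sigma_{\max}(W(t))L(t)\eta_t^2+3K\sigma_{\max}^2(\mathcal{T}_t)\sqrt{2KL(t)}\,\eta_t .$$ Then $$L(t+1)\le L(t)-\Bigl(\eta_t-\frac{K_t\eta_t^2}{2}\Bigr)\|\nabla L(t)\|_F^2,\qquad \frac12\|\nabla L(t)\|_F^2\ge \mu_t L(t).$$ Moreover, if the step size satisfies $\eta_t>0$ and $\eta_tK_t<2$, then $$L(t+1)\le L(t)\,\bigl(1-2\mu_t\eta_t+\mu_tK_t\eta_t^2\bigr).$$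
   Context: $K$-smooth means $\ell(V)\le \ell(W)+\langle\nabla\ell(W),V-W\rangle+\frac K2\|V-W\|_F^2$ for all $V,W$ (equivalently, for the convex $\ell$ here, $\nabla\ell$ is $K$-Lipschitz in Frobenius norm). Gradient descent: $W_1(t+1)=W_1(t)-\eta_t\nabla\ell(W(t))W_2(t)$ and $W_2(t+1)=W_2(t)-\eta_t\nabla\ell(W(t))^\top W_1(t)$, where $W(t)=W_1(t)W_2(t)^\top$, started from arbitrary $(W_1(0),W_2(0))$. Write $L(t)=L(W_1(t),W_2(t))$ and $\nabla L(t)$ for the (full) gradient of $L$ at $(W_1(t),W_2(t))$, i.e. the stacked matrix of $\nabla_{W_1}L(t)=\nabla\ell(W(t))W_2(t)$ and $\nabla_{W_2}L(t)=\nabla\ell(W(t))^\top W_1(t)$. For fixed $(W_1,W_2)$, $\mathcal{T}(\,\cdot\,;W_1,W_2):\mathbb{R}^{n\times m}\to\mathbb{R}^{(n+m)\times h}$ is the linear operator $U\mapsto \begin{bmatrix}UW_2\\ U^\top W_1\end{bmatrix}$, and $\mathcal{T}_t=\mathcal{T}(\,\cdot\,;W_1(t),W_2(t))$. Its largest and smallest singular values satisfy $\sigma_{\max}^2(\mathcal{T})=\lambda_{\max}(\mathcal{T}^*\circ\mathcal{T})$ and $\sigma_{\min}^2(\mathcal{T})=\lambda_{\min}(\mathcal{T}^*\circ\mathcal{T})$ (with respect to Frobenius inner products). $\sigma_{\max}(W)$ is the largest singular value of a matrix $W$. *)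

theory Defs
  imports "HOL-Analysis.Analysis"
begin

text \<open>
  An \<open>n \<times> m\<close> matrix is an element of \<open>real ^ 'm ^ 'n\<close>. On this type the library's inner product
  is the Frobenius inner product and \<open>norm\<close> is the Frobenius norm (not the operator norm).
\<close>

text \<open>Unspecified at points where \<open>f\<close> is not differentiable.\<close>

definition grad :: "('a::euclidean_space \<Rightarrow> real) \<Rightarrow> 'a \<Rightarrow> 'a" where
  "grad f x = (THE D. GDERIV f x :> D)"

definition twice_differentiable :: "('a::euclidean_space \<Rightarrow> real) \<Rightarrow> bool" where
  "twice_differentiable f \<longleftrightarrow>
     (\<forall>x. f differentiable (at x)) \<and> (\<forall>x. grad f differentiable (at x))"

definition smooth_fun :: "real \<Rightarrow> ('a::euclidean_space \<Rightarrow> real) \<Rightarrow> bool" where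
  "smooth_fun K f \<longleftrightarrow>
     (\<forall>V W. f V \<le> f W + grad f W \<bullet> (V - W) + K / 2 * (norm (V - W))\<^sup>2)"

definition strongly_convex :: "real \<Rightarrow> ('a::euclidean_space \<Rightarrow> real) \<Rightarrow> bool" where
  "strongly_convex \<mu> f \<longleftrightarrow>
     (\<forall>V W. f V \<ge> f W + grad f W \<bullet> (V - W) + \<mu> / 2 * (norm (V - W))\<^sup>2)"

definition eigenvalues :: "('a::euclidean_space \<Rightarrow> 'a) \<Rightarrow> real set" where
  "eigenvalues f = {c. \<exists>v. v \<noteq> 0 \<and> f v = c *\<^sub>R v}"

definition lambda_max :: "('a::euclidean_space \<Rightarrow> 'a) \<Rightarrow> real" where
  "lambda_max f = Max (eigenvalues f)"

definition lambda_min :: "('a::euclidean_space \<Rightarrow> 'a) \<Rightarrow> real" where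
  "lambda_min f = Min (eigenvalues f)"

text \<open>
  Extreme singular values of a linear operator. The Gram operator \<open>adjoint f \<circ> f\<close> acts on the
  domain of \<open>f\<close>, so \<open>sigma_min f = 0\<close> whenever \<open>f\<close> is not injective.
\<close>

definition sigma_max :: "('a::euclidean_space \<Rightarrow> 'b::euclidean_space) \<Rightarrow> real" where
  "sigma_max f = sqrt (lambda_max (adjoint f \<circ> f))"

definition sigma_min :: "('a::euclidean_space \<Rightarrow> 'b::euclidean_space) \<Rightarrow> real" where
  "sigma_min f = sqrt (lambda_min (adjoint f \<circ> f))"

definition matrix_sigma_max :: "real ^ 'm ^ 'n \<Rightarrow> real" where
  "matrix_sigma_max W = sigma_max (\<lambda>x. W *v x)"

definition stack :: "real ^ 'h ^ 'n \<Rightarrow> real ^ 'h ^ 'm \<Rightarrow> real ^ 'h ^ ('n + 'm)" where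
  "stack A B = (\<chi> i. case i of Inl a \<Rightarrow> A $ a | Inr b \<Rightarrow> B $ b)"

definition loss :: "(real ^ 'm ^ 'n \<Rightarrow> real) \<Rightarrow> real ^ 'h ^ 'n \<Rightarrow> real ^ 'h ^ 'm \<Rightarrow> real" where
  "loss l A B = l (A ** transpose B)"

definition grad_loss ::
    "(real ^ 'm ^ 'n \<Rightarrow> real) \<Rightarrow> real ^ 'h ^ 'n \<Rightarrow> real ^ 'h ^ 'm \<Rightarrow> real ^ 'h ^ ('n + 'm)" where
  "grad_loss l A B =
     (let g = grad (\<lambda>(V1, V2). loss l V1 V2) (A, B) in stack (fst g) (snd g))"

definition T_op ::
    "real ^ 'h ^ 'n \<Rightarrow> real ^ 'h ^ 'm \<Rightarrow> real ^ 'm ^ 'n \<Rightarrow> real ^ 'h ^ ('n + 'm)" where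
  "T_op A B U = stack (U ** B) (transpose U ** A)"

definition gradient_descent ::
    "(real ^ 'm ^ 'n \<Rightarrow> real) \<Rightarrow> (nat \<Rightarrow> real) \<Rightarrow> (nat \<Rightarrow> real ^ 'h ^ 'n) \<Rightarrow>
     (nat \<Rightarrow> real ^ 'h ^ 'm) \<Rightarrow> bool" where
  "gradient_descent l \<eta> W1 W2 \<longleftrightarrow>
     (\<forall>t. let G = grad l (W1 t ** transpose (W2 t)) in
        W1 (Suc t) = W1 t - \<eta> t *\<^sub>R (G ** W2 t) \<and>
        W2 (Suc t) = W2 t - \<eta> t *\<^sub>R (transpose G ** W1 t))"

definition mu_at :: "real \<Rightarrow> real ^ 'h ^ 'n \<Rightarrow> real ^ 'h ^ 'm \<Rightarrow> real" where
  "mu_at \<mu> A B = \<mu> * (sigma_min (T_op A B))\<^sup>2"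

definition K_at ::
    "real \<Rightarrow> (real ^ 'm ^ 'n \<Rightarrow> real) \<Rightarrow> real ^ 'h ^ 'n \<Rightarrow> real ^ 'h ^ 'm \<Rightarrow> real \<Rightarrow> real" where
  "K_at K l A B \<eta> =
     K * (sigma_max (T_op A B))\<^sup>2
     + sqrt (2 * K * loss l A B)
     + 6 * K\<^sup>2 * matrix_sigma_max (A ** transpose B) * loss l A B * \<eta>\<^sup>2
     + 3 * K * (sigma_max (T_op A B))\<^sup>2 * sqrt (2 * K * loss l A B) * \<eta>"

end

theory Submission
  imports Defs
begin

text \<open>
  Write \<open>W = A B\<^sup>T\<close>, \<open>G = \<nabla>l(W)\<close>, \<open>T = T_op A B\<close>, so that \<open>\<nabla>L\<close> is the stacked matrix \<open>T G\<close>. One step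
  of gradient descent changes \<open>W\<close> by \<open>-\<eta> T\<^sup>*T G + \<eta>\<^sup>2 P\<close> with \<open>P = (G B) (G\<^sup>T A)\<^sup>T = G W\<^sup>T G\<close>. Insert this
  into the smoothness inequality for \<open>l\<close>. The remainder \<open>P\<close> has the two bounds
  \<open>\<parallel>P\<parallel> \<le> \<parallel>G B\<parallel> \<parallel>G\<^sup>T A\<parallel> \<le> \<parallel>T G\<parallel>\<^sup>2 / 2\<close> and \<open>\<parallel>P\<parallel> \<le> \<sigma>\<^sub>m\<^sub>a\<^sub>x(W) \<parallel>G\<parallel>\<^sup>2\<close>, whose product bounds the
  fourth-order term; smoothness and nonnegativity give \<open>\<parallel>G\<parallel>\<^sup>2 \<le> 2 K l(W)\<close>. The second inequality is the
  Polyak-Lojasiewicz inequality \<open>\<parallel>G\<parallel>\<^sup>2 \<ge> 2 \<mu> l(W)\<close> composed with \<open>\<parallel>T G\<parallel> \<ge> \<sigma>\<^sub>m\<^sub>i\<^sub>n(T) \<parallel>G\<parallel>\<close>.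
\<close>

section \<open>Extreme singular values\<close>

text \<open>The form \<open>x \<bullet> S x\<close> is minimal at \<open>v\<close>, so its
  derivative there, twice \<open>S v\<close>, vanishes. Concretely, moving from \<open>v\<close> in
  the direction \<open>w = S v\<close> gives a quadratic in \<open>t\<close> without constant term;
  it can stay nonnegative only if its linear coefficient \<open>2 * (w \<bullet> w)\<close> is
  zero.\<close>

lemma psd_zero_imp_kernel:
  fixes S :: "'a::real_inner \<Rightarrow> 'a"
  assumes lin: "linear S" and sym: "\<And>x y. S x \<bullet> y = x \<bullet> S y"
    and psd: "\<And>x. x \<bullet> S x \<ge> 0" and zero: "v \<bullet> S v = 0"
  shows "S v = 0"
proof -
  define w where "w = S v"
  define q where "q = w \<bullet> S w"
  have vSw: "v \<bullet> S w = w \<bullet> w"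
    using sym[of v w] by (simp add: w_def)
  have quad: "0 \<le> 2 * t * (w \<bullet> w) + t\<^sup>2 * q" for t
  proof -
    have "0 \<le> (v + t *\<^sub>R w) \<bullet> S (v + t *\<^sub>R w)"
      by (rule psd)
    also have "\<dots> = v \<bullet> S v + t * (v \<bullet> S w) + t * (w \<bullet> S v) + t\<^sup>2 * q"
      by (simp add: linear_add[OF lin] linear_scale[OF lin] inner_add_left inner_add_right q_def
          power2_eq_square algebra_simps)
    also have "\<dots> = 2 * t * (w \<bullet> w) + t\<^sup>2 * q"
      using zero vSw by (simp add: w_def)
    finally show ?thesis .
  qed
  have q0: "q \<ge> 0"
    unfolding q_def by (rule psd)
  define a where "a = w \<bullet> w"
  \<comment> \<open>The minimizer of the quadratic would be \<open>- a / q\<close>; the shift to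
    \<open>q + 1\<close> also covers \<open>q = 0\<close> and still makes the value negative unless
    \<open>a = 0\<close>.\<close>
  define t where "t = - a / (q + 1)"
  have t: "t * (q + 1) = - a"
    using q0 by (simp add: t_def)
  have "0 \<le> (2 * t * a + t\<^sup>2 * q) * (q + 1)\<^sup>2"
    using quad[of t] by (simp add: a_def)
  also have "\<dots> = 2 * (t * (q + 1)) * a * (q + 1) + (t * (q + 1))\<^sup>2 * q"
    by (simp add: algebra_simps power2_eq_square)
  also have "\<dots> = - (a\<^sup>2 * (q + 2))"
    unfolding t by (simp add: algebra_simps power2_eq_square)
  finally have "a\<^sup>2 * (q + 2) \<le> 0" by simp
  then have "a = 0"
    using q0 by (simp add: mult_le_0_iff)
  then show ?thesis
    by (simp add: a_def w_def)
qed

lemma gram_inner: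
  fixes f :: "'a::euclidean_space \<Rightarrow> 'b::euclidean_space"
  assumes "linear f"
  shows "(adjoint f \<circ> f) x \<bullet> y = f x \<bullet> f y" "x \<bullet> (adjoint f \<circ> f) y = f x \<bullet> f y"
  using adjoint_clauses[OF assms] by auto

text \<open>\<open>Max\<close> and \<open>Min\<close> in \<open>lambda_max\<close> and
  \<open>lambda_min\<close> are informative only on finite sets. Eigenvectors of a symmetric
  operator for distinct eigenvalues are orthogonal, so choosing one per eigenvalue yields an
  independent, hence finite, family.\<close>

lemma finite_eigenvalues_gram:
  fixes f :: "'a::euclidean_space \<Rightarrow> 'b::euclidean_space"
  assumes lf: "linear f"
  shows "finite (eigenvalues (adjoint f \<circ> f))"
proof -
  let ?S = "adjoint f \<circ> f"
  define v where "v c = (SOME x. x \<noteq> 0 \<and> ?S x = c *\<^sub>R x)" for c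
  have v: "v c \<noteq> 0 \<and> ?S (v c) = c *\<^sub>R v c" if "c \<in> eigenvalues ?S" for c
    unfolding v_def using that by (intro someI_ex[where P = "\<lambda>x. x \<noteq> 0 \<and> ?S x = c *\<^sub>R x"])
      (simp add: eigenvalues_def)
  have orth: "v c \<bullet> v d = 0" if "c \<in> eigenvalues ?S" "d \<in> eigenvalues ?S" "c \<noteq> d" for c d
  proof -
    have "?S (v c) \<bullet> v d = v c \<bullet> ?S (v d)"
      by (simp only: gram_inner[OF lf])
    then have "c * (v c \<bullet> v d) = d * (v c \<bullet> v d)"
      using v[OF that(1)] v[OF that(2)] by simp
    then show ?thesis using that(3) by simp
  qed
  have inj: "inj_on v (eigenvalues ?S)"
  proof (rule inj_onI, rule ccontr)
    fix c d assume "c \<in> eigenvalues ?S" "d \<in> eigenvalues ?S" "v c = v d" "c \<noteq> d"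
    then show False using orth[of c d] v[of d] by simp
  qed
  have "independent (v ` eigenvalues ?S)"
  proof (rule pairwise_orthogonal_independent)
    show "pairwise orthogonal (v ` eigenvalues ?S)"
      by (auto simp only: pairwise_def orthogonal_def image_iff intro: orth)
    show "0 \<notin> v ` eigenvalues ?S"
      using v by force
  qed
  then have "finite (v ` eigenvalues ?S)"
    by (rule independent_imp_finite)
  then show ?thesis
    using inj by (rule finite_imageD)
qed

text \<open>Rayleigh quotient argument: by compactness \<open>x \<bullet> S x\<close> attains a
  maximum \<open>c\<close> on the unit sphere, at \<open>v\<close> say. Then \<open>c I - S\<close>
  is positive semidefinite with a form vanishing at \<open>v\<close>, so \<open>v\<close> lies in
  its kernel and is an eigenvector.\<close>

lemma symmetric_top_eigenvalue:
  fixes S :: "'a::euclidean_space \<Rightarrow> 'a"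
  assumes lin: "linear S" and sym: "\<And>x y. S x \<bullet> y = x \<bullet> S y"
  obtains c where "c \<in> eigenvalues S" "\<And>x. x \<bullet> S x \<le> c * (norm x)\<^sup>2"
proof -
  have contS: "continuous_on (sphere 0 1) S"
    using lin by (simp add: linear_continuous_on linear_conv_bounded_linear)
  have cont: "continuous_on (sphere 0 1) (\<lambda>x. x \<bullet> S x)"
    by (rule continuous_on_inner[OF continuous_on_id contS])
  have ne: "sphere (0::'a) 1 \<noteq> {}"
    by simp
  obtain v where v: "v \<in> sphere 0 1"
    and vmax: "\<forall>x\<in>sphere 0 1. x \<bullet> S x \<le> v \<bullet> S v"
    using continuous_attains_sup[OF compact_sphere ne cont] by blast
  define c where "c = v \<bullet> S v"
  have bound: "x \<bullet> S x \<le> c * (norm x)\<^sup>2" for x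
  proof (cases "x = 0")
    case False
    define u where "u = x /\<^sub>R norm x"
    have x: "x = norm x *\<^sub>R u"
      using False by (simp add: u_def)
    have "u \<in> sphere 0 1"
      using False by (simp add: u_def)
    then have "u \<bullet> S u \<le> c"
      using vmax by (simp add: c_def)
    then have "(norm x)\<^sup>2 * (u \<bullet> S u) \<le> (norm x)\<^sup>2 * c"
      by (intro mult_left_mono) auto
    moreover have "x \<bullet> S x = (norm x)\<^sup>2 * (u \<bullet> S u)"
      by (subst (1 2) x) (simp add: linear_scale[OF lin] power2_eq_square)
    ultimately show ?thesis by (simp add: mult.commute)
  qed simp
  have "c *\<^sub>R v - S v = 0"
  proof (rule psd_zero_imp_kernel[where S = "\<lambda>x. c *\<^sub>R x - S x"])
    show "linear (\<lambda>x. c *\<^sub>R x - S x)"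
      by (intro linear_compose_sub lin linear_scale_self)
    show "(c *\<^sub>R x - S x) \<bullet> y = x \<bullet> (c *\<^sub>R y - S y)" for x y
      by (simp add: inner_diff_left inner_diff_right sym)
    show "x \<bullet> (c *\<^sub>R x - S x) \<ge> 0" for x
      using bound[of x] by (simp add: inner_diff_right power2_norm_eq_inner)
    show "v \<bullet> (c *\<^sub>R v - S v) = 0"
      using v by (simp add: inner_diff_right c_def norm_eq_1)
  qed
  then have "S v = c *\<^sub>R v" by simp
  moreover have "v \<noteq> 0" using v by auto
  ultimately have "c \<in> eigenvalues S"
    unfolding eigenvalues_def by blast
  then show ?thesis
    using bound by (rule that)
qed

lemma symmetric_bottom_eigenvalue:
  fixes S :: "'a::euclidean_space \<Rightarrow> 'a"
  assumes lin: "linear S" and sym: "\<And>x y. S x \<bullet> y = x \<bullet> S y"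
  obtains c where "c \<in> eigenvalues S" "\<And>x. c * (norm x)\<^sup>2 \<le> x \<bullet> S x"
proof -
  obtain c where c: "c \<in> eigenvalues (\<lambda>x. - S x)" and bound: "\<And>x. x \<bullet> - S x \<le> c * (norm x)\<^sup>2"
    using symmetric_top_eigenvalue[of "\<lambda>x. - S x"] lin sym by (auto intro: linear_compose_neg)
  obtain v where "v \<noteq> 0" "- S v = c *\<^sub>R v"
    using c unfolding eigenvalues_def by blast
  then have "S v = (- c) *\<^sub>R v"
    by (metis minus_equation_iff scaleR_minus_left)
  then have "- c \<in> eigenvalues S"
    using \<open>v \<noteq> 0\<close> unfolding eigenvalues_def by blast
  moreover have "- c * (norm x)\<^sup>2 \<le> x \<bullet> S x" for x
    using bound[of x] by simp
  ultimately show ?thesis by (rule that)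
qed

lemma gram_top_eigenvalue:
  fixes f :: "'a::euclidean_space \<Rightarrow> 'b::euclidean_space"
  assumes lf: "linear f"
  obtains c where "c \<in> eigenvalues (adjoint f \<circ> f)" "\<And>x. (norm (f x))\<^sup>2 \<le> c * (norm x)\<^sup>2"
proof -
  have "linear (adjoint f \<circ> f)"
    by (intro linear_compose lf adjoint_linear)
  then obtain c where c: "c \<in> eigenvalues (adjoint f \<circ> f)"
    and bound: "\<And>x. x \<bullet> (adjoint f \<circ> f) x \<le> c * (norm x)\<^sup>2"
    using symmetric_top_eigenvalue[of "adjoint f \<circ> f"] gram_inner[OF lf] by metis
  show ?thesis
    using c bound by (intro that) (simp_all only: gram_inner[OF lf] power2_norm_eq_inner)
qed

lemma gram_bottom_eigenvalue:
  fixes f :: "'a::euclidean_space \<Rightarrow> 'b::euclidean_space"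
  assumes lf: "linear f"
  obtains c where "c \<in> eigenvalues (adjoint f \<circ> f)" "\<And>x. c * (norm x)\<^sup>2 \<le> (norm (f x))\<^sup>2"
proof -
  have "linear (adjoint f \<circ> f)"
    by (intro linear_compose lf adjoint_linear)
  then obtain c where c: "c \<in> eigenvalues (adjoint f \<circ> f)"
    and bound: "\<And>x. c * (norm x)\<^sup>2 \<le> x \<bullet> (adjoint f \<circ> f) x"
    using symmetric_bottom_eigenvalue[of "adjoint f \<circ> f"] gram_inner[OF lf] by metis
  show ?thesis
    using c bound by (intro that) (simp_all only: gram_inner[OF lf] power2_norm_eq_inner)
qed

text \<open>For an eigenvector \<open>v\<close>, \<open>c\<close> times its squared norm is the
  squared norm of \<open>f v\<close>. This allows the square root in \<open>sigma_min\<close> to be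
  undone by squaring.\<close>

lemma eigenvalues_gram_nonneg:
  fixes f :: "'a::euclidean_space \<Rightarrow> 'b::euclidean_space"
  assumes lf: "linear f" and "c \<in> eigenvalues (adjoint f \<circ> f)"
  shows "c \<ge> 0"
proof -
  obtain v where v: "v \<noteq> 0" "(adjoint f \<circ> f) v = c *\<^sub>R v"
    using assms(2) unfolding eigenvalues_def by blast
  have "c * (v \<bullet> v) = f v \<bullet> f v"
    using gram_inner(1)[OF lf, of v v] v(2) by simp
  then have "0 \<le> c * (v \<bullet> v)" by simp
  moreover have "0 < v \<bullet> v"
    using v(1) by simp
  ultimately show ?thesis
    by (simp only: zero_le_mult_iff) linarith
qed

text \<open>The Rayleigh bound holds for some eigenvalue \<open>c\<close>, and
  \<open>c \<le> lambda_max\<close>; identifying the two is avoided.\<close>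

lemma norm_le_sigma_max:
  fixes f :: "'a::euclidean_space \<Rightarrow> 'b::euclidean_space"
  assumes lf: "linear f"
  shows "norm (f x) \<le> sigma_max f * norm x"
proof -
  obtain c where c: "c \<in> eigenvalues (adjoint f \<circ> f)" "\<And>x. (norm (f x))\<^sup>2 \<le> c * (norm x)\<^sup>2"
    using gram_top_eigenvalue[OF lf] by metis
  have "c \<le> lambda_max (adjoint f \<circ> f)"
    unfolding lambda_max_def by (intro Max_ge finite_eigenvalues_gram lf c)
  then have "(norm (f x))\<^sup>2 \<le> lambda_max (adjoint f \<circ> f) * (norm x)\<^sup>2"
    by (meson c(2) mult_right_mono order_trans zero_le_power2)
  then have "sqrt ((norm (f x))\<^sup>2) \<le> sqrt (lambda_max (adjoint f \<circ> f) * (norm x)\<^sup>2)"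
    by (rule real_sqrt_le_mono)
  then show ?thesis
    by (simp add: sigma_max_def real_sqrt_mult)
qed

text \<open>Not immediate from the definition, because \<open>sqrt\<close> is negative on negative
  reals. The operator bound at a unit vector settles it.\<close>

lemma sigma_max_nonneg:
  fixes f :: "'a::euclidean_space \<Rightarrow> 'b::euclidean_space"
  assumes lf: "linear f"
  shows "sigma_max f \<ge> 0"
proof -
  obtain b :: 'a where "norm b = 1"
    using vector_choose_size[of 1] by auto
  then show ?thesis
    using order_trans[OF norm_ge_zero norm_le_sigma_max[OF lf, of b]] by simp
qed

text \<open>Duality: pair \<open>adjoint f y\<close> with itself, move the adjoint across, apply
  Cauchy-Schwarz and the bound for \<open>f\<close>, then cancel one factor.\<close>

lemma norm_adjoint_le_sigma_max:
  fixes f :: "'a::euclidean_space \<Rightarrow> 'b::euclidean_space"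
  assumes lf: "linear f"
  shows "norm (adjoint f y) \<le> sigma_max f * norm y"
proof (cases "adjoint f y = 0")
  case True
  then show ?thesis using sigma_max_nonneg[OF lf] by simp
next
  case False
  have "norm (adjoint f y) * norm (adjoint f y) = f (adjoint f y) \<bullet> y"
    by (simp add: adjoint_works[OF lf, symmetric] power2_norm_eq_inner[symmetric] power2_eq_square)
  also have "\<dots> \<le> norm (f (adjoint f y)) * norm y"
    by (rule norm_cauchy_schwarz)
  also have "\<dots> \<le> sigma_max f * norm (adjoint f y) * norm y"
    by (intro mult_right_mono norm_le_sigma_max lf) simp
  finally have "norm (adjoint f y) * norm (adjoint f y) \<le> norm (adjoint f y) * (sigma_max f * norm y)"
    by (simp add: mult_ac)
  then show ?thesis
    using False by simp
qed

text \<open>The bottom eigenvalue \<open>c\<close> also shows that the spectrum is nonempty, so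
  \<open>lambda_min\<close> is itself an eigenvalue and therefore nonnegative.\<close>

lemma norm_ge_sigma_min:
  fixes f :: "'a::euclidean_space \<Rightarrow> 'b::euclidean_space"
  assumes lf: "linear f"
  shows "(sigma_min f)\<^sup>2 * (norm x)\<^sup>2 \<le> (norm (f x))\<^sup>2"
proof -
  obtain c where c: "c \<in> eigenvalues (adjoint f \<circ> f)" "\<And>x. c * (norm x)\<^sup>2 \<le> (norm (f x))\<^sup>2"
    using gram_bottom_eigenvalue[OF lf] by metis
  have "lambda_min (adjoint f \<circ> f) \<in> eigenvalues (adjoint f \<circ> f)"
    unfolding lambda_min_def using c(1) by (intro Min_in finite_eigenvalues_gram lf) auto
  then have "(sigma_min f)\<^sup>2 = lambda_min (adjoint f \<circ> f)"
    by (simp add: sigma_min_def eigenvalues_gram_nonneg[OF lf])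
  moreover have "lambda_min (adjoint f \<circ> f) \<le> c"
    unfolding lambda_min_def by (intro Min_le finite_eigenvalues_gram lf c)
  ultimately have "(sigma_min f)\<^sup>2 * (norm x)\<^sup>2 \<le> c * (norm x)\<^sup>2"
    by (simp add: mult_right_mono)
  then show ?thesis
    using c(2)[of x] by linarith
qed

section \<open>Gradients of smooth and strongly convex functions\<close>

lemma grad_eqI: "GDERIV f x :> D \<Longrightarrow> grad f x = D"
  unfolding grad_def
proof (rule the_equality)
  fix D' assume "GDERIV f x :> D" "GDERIV f x :> D'"
  then have "(\<lambda>h. h \<bullet> D) = (\<lambda>h. h \<bullet> D')"
    unfolding gderiv_def by (rule has_derivative_unique)
  then show "D' = D"
    by (metis vector_eq_ldot)
qed

text \<open>The Riesz vector of the real-valued derivative \<open>f'\<close> is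
  \<open>adjoint f' 1\<close>.\<close>

lemma GDERIV_grad:
  assumes "f differentiable (at x)"
  shows "GDERIV f x :> grad f x"
proof -
  obtain f' where f': "(f has_derivative f') (at x)"
    using assms unfolding differentiable_def by blast
  have "f' = (\<lambda>h. h \<bullet> adjoint f' 1)"
    using adjoint_works[OF has_derivative_linear[OF f'], of _ 1] by simp
  then have "GDERIV f x :> adjoint f' 1"
    unfolding gderiv_def using f' by simp
  then show ?thesis
    by (simp add: grad_eqI)
qed

text \<open>A step of size \<open>1 / K\<close> against the gradient minimizes the quadratic upper
  model of \<open>f\<close> at \<open>x\<close>; the minimal value, \<open>f x\<close> minus the
  squared gradient norm over \<open>2 * K\<close>, cannot be negative.\<close>

lemma norm_grad_le_smooth:
  assumes smooth: "smooth_fun K f" and "K > 0" and nonneg: "\<forall>x. f x \<ge> 0"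
  shows "(norm (grad f x))\<^sup>2 \<le> 2 * K * f x"
proof -
  let ?g = "grad f x"
  have "0 \<le> f (x - (1 / K) *\<^sub>R ?g)"
    using nonneg by blast
  also have "\<dots> \<le> f x + ?g \<bullet> ((x - (1 / K) *\<^sub>R ?g) - x) + K / 2 * (norm ((x - (1 / K) *\<^sub>R ?g) - x))\<^sup>2"
    using smooth unfolding smooth_fun_def by blast
  also have "\<dots> = f x - (norm ?g)\<^sup>2 / (2 * K)"
    using \<open>K > 0\<close> by (simp add: dot_square_norm power_mult_distrib)
      (simp add: field_simps power2_eq_square)
  finally show ?thesis
    using \<open>K > 0\<close> by (simp add: field_simps)
qed

text \<open>Completing the square bounds the quadratic lower model from below by \<open>f x\<close>
  minus the squared gradient norm over \<open>2 * \<mu>\<close>, and at the zero \<open>y\<close>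
  that model is at most 0.\<close>

lemma Polyak_Lojasiewicz:
  assumes sc: "strongly_convex \<mu> f" and "\<mu> > 0" and zero: "f y = 0"
  shows "2 * \<mu> * f x \<le> (norm (grad f x))\<^sup>2"
proof -
  let ?g = "grad f x"
  have "0 \<le> (norm (?g + \<mu> *\<^sub>R (y - x)))\<^sup>2"
    by simp
  also have "\<dots> = (norm ?g)\<^sup>2 + 2 * \<mu> * (?g \<bullet> (y - x) + \<mu> / 2 * (norm (y - x))\<^sup>2)"
    unfolding power2_norm_eq_inner
    by (simp add: inner_add_left inner_add_right inner_commute[of "y - x" ?g] distrib_left
        del: inner_diff_left inner_diff_right)
  also have "\<dots> \<le> (norm ?g)\<^sup>2 + 2 * \<mu> * (- f x)"
  proof -
    have "f y \<ge> f x + ?g \<bullet> (y - x) + \<mu> / 2 * (norm (y - x))\<^sup>2"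
      using sc unfolding strongly_convex_def by blast
    then show ?thesis
      using \<open>\<mu> > 0\<close> zero by (intro add_left_mono mult_left_mono) auto
  qed
  finally show ?thesis by simp
qed

text \<open>The upper and lower quadratic models at 0 are compared at a unit vector.\<close>

lemma smooth_ge_strongly_convex:
  fixes f :: "'a::euclidean_space \<Rightarrow> real"
  assumes "smooth_fun K f" "strongly_convex \<mu> f"
  shows "\<mu> \<le> K"
proof -
  obtain v :: 'a where v: "norm v = 1"
    using vector_choose_size[of 1] by auto
  have "f v \<le> f 0 + grad f 0 \<bullet> (v - 0) + K / 2 * (norm (v - 0))\<^sup>2"
    using assms(1) unfolding smooth_fun_def by blast
  moreover have "f v \<ge> f 0 + grad f 0 \<bullet> (v - 0) + \<mu> / 2 * (norm (v - 0))\<^sup>2"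
    using assms(2) unfolding strongly_convex_def by blast
  ultimately show ?thesis using v by simp
qed

section \<open>Frobenius inner product\<close>

lemma linear_transpose: "linear (transpose :: real ^ 'm ^ 'n \<Rightarrow> real ^ 'n ^ 'm)"
  by (rule linearI) (simp_all add: transpose_def vec_eq_iff)

lemma bounded_bilinear_matrix_mult:
  "bounded_bilinear ((**) :: real ^ 'k ^ 'n \<Rightarrow> real ^ 'm ^ 'k \<Rightarrow> real ^ 'm ^ 'n)"
  unfolding bilinear_conv_bounded_bilinear[symmetric] bilinear_def
  by (auto intro!: linearI simp: matrix_matrix_mult_def vec_eq_iff sum.distrib sum_distrib_left
      algebra_simps)

lemmas matrix_mult_simps =
  bounded_bilinear.diff_left[OF bounded_bilinear_matrix_mult]
  bounded_bilinear.diff_right[OF bounded_bilinear_matrix_mult]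
  bounded_bilinear.scaleR_left[OF bounded_bilinear_matrix_mult]
  bounded_bilinear.scaleR_right[OF bounded_bilinear_matrix_mult]
  bounded_bilinear.add_left[OF bounded_bilinear_matrix_mult]

lemma inner_transpose_transpose:
  fixes X Y :: "real ^ 'm ^ 'n"
  shows "transpose X \<bullet> transpose Y = X \<bullet> Y"
  unfolding inner_vec_def transpose_def by (simp, rule sum.swap)

lemma inner_matrix_mult_left:
  fixes X :: "real ^ 'k ^ 'n" and Y :: "real ^ 'm ^ 'k"
  shows "(X ** Y) \<bullet> Z = X \<bullet> (Z ** transpose Y)"
proof -
  have "(\<Sum>j\<in>UNIV. (\<Sum>k\<in>UNIV. X $ i $ k * Y $ k $ j) * Z $ i $ j)
      = (\<Sum>k\<in>UNIV. X $ i $ k * (\<Sum>j\<in>UNIV. Z $ i $ j * Y $ k $ j))" for i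
    unfolding sum_distrib_left sum_distrib_right
    by (subst sum.swap) (simp add: mult_ac)
  then show ?thesis
    unfolding inner_vec_def matrix_matrix_mult_def transpose_def by simp
qed

text \<open>The adjoint of \<open>Y \<mapsto> A ** transpose Y\<close>; it produces the second block
  \<open>transpose G ** A\<close> of the gradient.\<close>

lemma inner_matrix_mult_transpose_right:
  fixes A :: "real ^ 'h ^ 'n" and Y :: "real ^ 'h ^ 'm"
  shows "(A ** transpose Y) \<bullet> Z = Y \<bullet> (transpose Z ** A)"
proof -
  have "(A ** transpose Y) \<bullet> Z = (Y ** transpose A) \<bullet> transpose Z"
    by (metis inner_transpose_transpose matrix_transpose_mul transpose_transpose)
  also have "\<dots> = Y \<bullet> (transpose Z ** A)"
    by (simp add: inner_matrix_mult_left)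
  finally show ?thesis .
qed

lemma norm_transpose: "norm (transpose X) = norm (X :: real ^ 'm ^ 'n)"
  by (simp add: norm_eq_sqrt_inner inner_transpose_transpose)

lemma power2_norm_vec: "(norm (X :: 'a::real_inner ^ 'n))\<^sup>2 = (\<Sum>i\<in>UNIV. (norm (X $ i))\<^sup>2)"
  by (simp add: power2_norm_eq_inner inner_vec_def)

lemma power2_norm_matrix:
  "(norm (X :: real ^ 'm ^ 'n))\<^sup>2 = (\<Sum>i\<in>UNIV. \<Sum>j\<in>UNIV. (X $ i $ j)\<^sup>2)"
  by (simp add: power2_norm_vec)

lemma matrix_mult_transpose_nth:
  fixes X :: "real ^ 'k ^ 'n" and Y :: "real ^ 'k ^ 'm"
  shows "(X ** transpose Y) $ i $ j = X $ i \<bullet> Y $ j"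
  by (simp add: matrix_matrix_mult_def transpose_def inner_vec_def)

text \<open>The entries of the product are inner products of rows, so Cauchy-Schwarz applies
  entrywise and the double sum factors.\<close>

lemma norm_matrix_mult_transpose_le:
  fixes X :: "real ^ 'k ^ 'n" and Y :: "real ^ 'k ^ 'm"
  shows "norm (X ** transpose Y) \<le> norm X * norm Y"
proof (rule power2_le_imp_le)
  have "(norm (X ** transpose Y))\<^sup>2 = (\<Sum>i\<in>UNIV. \<Sum>j\<in>UNIV. (X $ i \<bullet> Y $ j)\<^sup>2)"
    by (simp add: power2_norm_matrix matrix_mult_transpose_nth)
  also have "\<dots> \<le> (\<Sum>i\<in>UNIV. \<Sum>j\<in>UNIV. (norm (X $ i))\<^sup>2 * (norm (Y $ j))\<^sup>2)"
    by (intro sum_mono) (simp add: power2_norm_eq_inner Cauchy_Schwarz_ineq)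
  also have "\<dots> = (norm X * norm Y)\<^sup>2"
    by (simp add: power_mult_distrib power2_norm_vec sum_product)
  finally show "(norm (X ** transpose Y))\<^sup>2 \<le> (norm X * norm Y)\<^sup>2" .
qed simp

text \<open>The rows of \<open>X ** transpose W\<close> are the images under \<open>W\<close> of the
  rows of \<open>X\<close>, so the operator bound applies row by row.\<close>

lemma norm_mult_transpose_le_sigma_max:
  fixes X :: "real ^ 'k ^ 'n" and W :: "real ^ 'k ^ 'm"
  shows "norm (X ** transpose W) \<le> matrix_sigma_max W * norm X"
proof (rule power2_le_imp_le)
  have lW: "linear (\<lambda>x. W *v x)" by simp
  have nth: "(X ** transpose W) $ i = W *v (X $ i)" for i
    by (simp add: vec_eq_iff matrix_mult_transpose_nth matrix_vector_mult_def inner_vec_def mult.commute)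
  have "(norm (X ** transpose W))\<^sup>2 = (\<Sum>i\<in>UNIV. (norm (W *v (X $ i)))\<^sup>2)"
    by (simp add: power2_norm_vec[of "X ** transpose W"] nth)
  also have "\<dots> \<le> (\<Sum>i\<in>UNIV. (matrix_sigma_max W * norm (X $ i))\<^sup>2)"
    unfolding matrix_sigma_max_def by (intro sum_mono power_mono norm_le_sigma_max[OF lW]) simp
  also have "\<dots> = (matrix_sigma_max W * norm X)\<^sup>2"
    by (simp add: power_mult_distrib power2_norm_vec[of X] sum_distrib_left)
  finally show "(norm (X ** transpose W))\<^sup>2 \<le> (matrix_sigma_max W * norm X)\<^sup>2" .
  show "0 \<le> matrix_sigma_max W * norm X"
    unfolding matrix_sigma_max_def by (simp add: sigma_max_nonneg[OF lW])
qed

section \<open>The factorized loss\<close>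

lemma inner_stack:
  fixes X X' :: "real ^ 'h ^ 'n" and Y Y' :: "real ^ 'h ^ 'm"
  shows "stack X Y \<bullet> stack X' Y' = X \<bullet> X' + Y \<bullet> Y'"
proof -
  have "stack X Y \<bullet> stack X' Y'
      = (\<Sum>i\<in>(UNIV :: 'n set) <+> (UNIV :: 'm set). stack X Y $ i \<bullet> stack X' Y' $ i)"
    by (simp add: inner_vec_def[of "stack X Y"])
  also have "\<dots> = X \<bullet> X' + Y \<bullet> Y'"
    by (subst sum.Plus) (simp_all add: stack_def inner_vec_def[of X] inner_vec_def[of Y])
  finally show ?thesis .
qed

lemma linear_T_op:
  fixes A :: "real ^ 'h ^ 'n" and B :: "real ^ 'h ^ 'm"
  shows "linear (T_op A B)"
proof (rule linearI)
  show "T_op A B (U + V) = T_op A B U + T_op A B V" for U V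
    unfolding T_op_def linear_add[OF linear_transpose] matrix_mult_simps
    by (simp add: stack_def vec_eq_iff split: sum.split)
  show "T_op A B (c *\<^sub>R U) = c *\<^sub>R T_op A B U" for c U
    unfolding T_op_def linear_scale[OF linear_transpose] matrix_mult_simps
    by (simp add: stack_def vec_eq_iff split: sum.split)
qed

text \<open>The right-hand side is the derivative of the product \<open>A ** transpose B\<close> in
  the direction \<open>(X, Y)\<close>. Hence a gradient step moves the product, to first order,
  along the Gram operator of \<open>T_op A B\<close>.\<close>

lemma adjoint_T_op_stack:
  fixes A X :: "real ^ 'h ^ 'n" and B Y :: "real ^ 'h ^ 'm"
  shows "adjoint (T_op A B) (stack X Y) = X ** transpose B + A ** transpose Y"
proof -
  have "U \<bullet> adjoint (T_op A B) (stack X Y) = U \<bullet> (X ** transpose B + A ** transpose Y)" for U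
  proof -
    have "U \<bullet> adjoint (T_op A B) (stack X Y) = (U ** B) \<bullet> X + (transpose U ** A) \<bullet> Y"
      by (simp add: adjoint_works[OF linear_T_op] T_op_def inner_stack)
    also have "\<dots> = U \<bullet> (X ** transpose B) + Y \<bullet> (transpose U ** A)"
      by (simp add: inner_matrix_mult_left[of U] inner_commute[of Y])
    also have "\<dots> = U \<bullet> (X ** transpose B + A ** transpose Y)"
      by (simp add: inner_matrix_mult_transpose_right[symmetric] inner_add_right inner_commute)
    finally show ?thesis .
  qed
  then show ?thesis
    by (metis vector_eq_ldot)
qed

text \<open>Chain rule on the product space of pairs; the Frobenius adjoints then rewrite the
  derivative as an inner product with a pair, whose stacking is \<open>T_op A B\<close> applied to
  the gradient of \<open>l\<close>.\<close>

lemma grad_loss_eq_T_op: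
  fixes l :: "real ^ 'm ^ 'n \<Rightarrow> real" and A :: "real ^ 'h ^ 'n" and B :: "real ^ 'h ^ 'm"
  assumes diff: "l differentiable (at (A ** transpose B))"
  shows "grad_loss l A B = T_op A B (grad l (A ** transpose B))"
proof -
  let ?G = "grad l (A ** transpose B)"
  have prod: "((\<lambda>x. fst x ** transpose (snd x)) has_derivative
      (\<lambda>h. A ** transpose (snd h) + fst h ** transpose B)) (at (A, B))"
  proof -
    have "((\<lambda>x :: (real ^ 'h ^ 'n) \<times> (real ^ 'h ^ 'm). transpose (snd x)) has_derivative
        (\<lambda>h. transpose (snd h))) (at (A, B))"
      by (intro bounded_linear.has_derivative[OF linear_conv_bounded_linear[THEN iffD1, OF linear_transpose]]
          has_derivative_snd has_derivative_ident)
    from bounded_bilinear.FDERIV[OF bounded_bilinear_matrix_mult has_derivative_fst[OF has_derivative_ident] this]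
    show ?thesis by simp
  qed
  have "(l has_derivative (\<lambda>h. h \<bullet> ?G)) (at (A ** transpose B))"
    using GDERIV_grad[OF diff] unfolding gderiv_def .
  then have "(l has_derivative (\<lambda>h. h \<bullet> ?G)) (at (fst (A, B) ** transpose (snd (A, B))))"
    by simp
  from has_derivative_compose[OF prod this]
  have "((\<lambda>x. l (fst x ** transpose (snd x))) has_derivative
      (\<lambda>h. (A ** transpose (snd h) + fst h ** transpose B) \<bullet> ?G)) (at (A, B))" .
  moreover have "(A ** transpose (snd h) + fst h ** transpose B) \<bullet> ?G
      = h \<bullet> (?G ** B, transpose ?G ** A)" for h
    by (simp add: inner_add_left inner_matrix_mult_transpose_right[of A "snd h"] inner_matrix_mult_left[of "fst h"]
        inner_prod_def)
  ultimately have "GDERIV (\<lambda>(V1, V2). loss l V1 V2) (A, B) :> (?G ** B, transpose ?G ** A)"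
    unfolding gderiv_def loss_def case_prod_unfold by simp
  then show ?thesis
    unfolding grad_loss_def T_op_def by (simp add: grad_eqI)
qed

text \<open>Every error term is bounded by a multiple of \<open>d\<close>, the squared norm of
  \<open>T_op A B G\<close>, so that all of them can be weighed against the first-order decrease
  \<open>\<eta> * d\<close>.\<close>

lemma descent_step:
  fixes l :: "real ^ 'm ^ 'n \<Rightarrow> real" and A :: "real ^ 'h ^ 'n" and B :: "real ^ 'h ^ 'm"
  assumes smooth: "smooth_fun K l" and "K > 0" and nonneg: "\<forall>W. l W \<ge> 0" and "\<eta> > 0"
  defines "G \<equiv> grad l (A ** transpose B)"
  shows "loss l (A - \<eta> *\<^sub>R (G ** B)) (B - \<eta> *\<^sub>R (transpose G ** A))
    \<le> loss l A B - (\<eta> - K_at K l A B \<eta> * \<eta>\<^sup>2 / 2) * (norm (T_op A B G))\<^sup>2"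
proof -
  define W where "W = A ** transpose B"
  define W' where "W' = (A - \<eta> *\<^sub>R (G ** B)) ** transpose (B - \<eta> *\<^sub>R (transpose G ** A))"
  define X where "X = G ** B"
  define Y where "Y = transpose G ** A"
  define S where "S = adjoint (T_op A B) (T_op A B G)"
  define P where "P = X ** transpose Y"
  define d where "d = (norm (T_op A B G))\<^sup>2"
  define s where "s = sigma_max (T_op A B)"
  define w where "w = matrix_sigma_max W"
  define g where "g = norm G"
  define r where "r = sqrt (2 * K * l W)"
  have T: "T_op A B G = stack X Y"
    by (simp add: T_op_def X_def Y_def)
  have S: "S = X ** transpose B + A ** transpose Y"
    by (simp add: S_def T adjoint_T_op_stack)
  have step: "W' - W = \<eta>\<^sup>2 *\<^sub>R P - \<eta> *\<^sub>R S"
    unfolding W'_def W_def S P_def X_def[symmetric] Y_def[symmetric]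
      linear_diff[OF linear_transpose] linear_scale[OF linear_transpose] matrix_mult_simps
    by (simp add: algebra_simps power2_eq_square)
  have g2: "g\<^sup>2 \<le> 2 * K * l W"
    unfolding g_def G_def W_def by (rule norm_grad_le_smooth[OF smooth \<open>K > 0\<close> nonneg])
  then have gr: "g \<le> r"
    unfolding r_def by (rule real_le_rsqrt)
  have s0: "s \<ge> 0" and w0: "w \<ge> 0" and g0: "g \<ge> 0" and d0: "d \<ge> 0"
    unfolding s_def w_def matrix_sigma_max_def g_def d_def
    by (simp_all add: sigma_max_nonneg linear_T_op)
  have d_eq: "d = (norm X)\<^sup>2 + (norm Y)\<^sup>2"
    by (simp add: d_def T power2_norm_eq_inner inner_stack)
  have Pd: "norm P \<le> d / 2"
  proof -
    have "norm P \<le> norm X * norm Y"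
      unfolding P_def by (rule norm_matrix_mult_transpose_le)
    also have "\<dots> \<le> d / 2"
      using sum_squares_bound[of "norm X" "norm Y"] by (simp add: d_eq)
    finally show ?thesis .
  qed
  have Pw: "norm P \<le> w * g\<^sup>2"
  proof -
    \<comment> \<open>Regrouped so that \<open>W\<close> acts as an operator on the rows of
      \<open>G\<close>, which brings in its largest singular value instead of its Frobenius
      norm.\<close>
    have "P = (G ** transpose W) ** transpose (transpose G)"
      by (simp add: P_def X_def Y_def W_def matrix_transpose_mul matrix_mul_assoc)
    then have "norm P \<le> norm (G ** transpose W) * norm (transpose G)"
      using norm_matrix_mult_transpose_le by metis
    also have "\<dots> \<le> (w * g) * g"
      unfolding w_def g_def norm_transpose
      by (intro mult_right_mono norm_mult_transpose_le_sigma_max) simp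
    finally show ?thesis by (simp add: power2_eq_square mult.assoc)
  qed
  have GS: "G \<bullet> S = d"
    by (simp add: S_def adjoint_works[OF linear_T_op] d_def power2_norm_eq_inner)
  have GP: "G \<bullet> P \<le> r * (d / 2)"
  proof -
    have "G \<bullet> P \<le> g * norm P"
      unfolding g_def by (rule norm_cauchy_schwarz)
    also have "\<dots> \<le> r * (d / 2)"
      using gr Pd g0 d0 by (intro mult_mono) auto
    finally show ?thesis .
  qed
  have S1: "norm S \<le> s * norm (T_op A B G)"
    unfolding S_def s_def by (intro norm_adjoint_le_sigma_max linear_T_op)
  then have SS: "(norm S)\<^sup>2 \<le> s\<^sup>2 * d"
    unfolding d_def by (metis norm_ge_zero power_mono power_mult_distrib)
  \<comment> \<open>\<open>SS\<close> keeps the factor \<open>d\<close> for the second-order term.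
    In the cross term \<open>S \<bullet> P\<close> the factor \<open>d\<close> is supplied by
    \<open>P\<close>, so \<open>S\<close> is bounded through \<open>g \<le> r\<close>
    instead.\<close>
  have S2: "norm S \<le> s\<^sup>2 * r"
  proof -
    have "norm S \<le> s * (s * g)"
      using S1 mult_left_mono[OF norm_le_sigma_max[OF linear_T_op, of A B G] s0]
      unfolding s_def g_def by linarith
    also have "\<dots> \<le> s * (s * r)"
      using s0 gr by (intro mult_left_mono) auto
    finally show ?thesis by (simp add: power2_eq_square mult.assoc)
  qed
  have SP: "- (S \<bullet> P) \<le> s\<^sup>2 * r * (d / 2)"
  proof -
    have "- (S \<bullet> P) \<le> norm S * norm P"
      using Cauchy_Schwarz_ineq2[of S P] by linarith
    also have "\<dots> \<le> s\<^sup>2 * r * (d / 2)"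
      using S2 Pd by (intro mult_mono) (auto intro: order_trans[OF norm_ge_zero])
    finally show ?thesis .
  qed
  have PP: "(norm P)\<^sup>2 \<le> w * (2 * K * l W) * (d / 2)"
  proof -
    have "norm P \<le> w * (2 * K * l W)"
      using Pw mult_left_mono[OF g2 w0] by linarith
    then show ?thesis
      unfolding power2_eq_square using Pd
      by (intro mult_mono) (auto simp only: norm_ge_zero intro: order_trans[OF norm_ge_zero])
  qed
  have sq: "(norm (W' - W))\<^sup>2 = \<eta>\<^sup>2 * (norm S)\<^sup>2 + 2 * \<eta> ^ 3 * (- (S \<bullet> P)) + \<eta> ^ 4 * (norm P)\<^sup>2"
    unfolding step power2_norm_eq_inner
    by (simp add: inner_diff_left inner_diff_right inner_commute[of P S] algebra_simps
        power2_eq_square power3_eq_cube power4_eq_xxxx)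
  also have "\<dots> \<le> \<eta>\<^sup>2 * (s\<^sup>2 * d) + 2 * \<eta> ^ 3 * (s\<^sup>2 * r * (d / 2))
      + \<eta> ^ 4 * (w * (2 * K * l W) * (d / 2))"
    using \<open>\<eta> > 0\<close> by (intro add_mono mult_left_mono SS SP PP) auto
  finally have quad: "(norm (W' - W))\<^sup>2 \<le> \<dots>" .
  have linear_term: "G \<bullet> (W' - W) \<le> \<eta>\<^sup>2 * (r * (d / 2)) - \<eta> * d"
    unfolding step inner_diff_right inner_scaleR_right GS
    using GP by (intro diff_right_mono mult_left_mono) auto
  have "l W' \<le> l W + G \<bullet> (W' - W) + K / 2 * (norm (W' - W))\<^sup>2"
    using smooth unfolding smooth_fun_def G_def W_def[symmetric] by blast
  also have "\<dots> \<le> l W + (\<eta>\<^sup>2 * (r * (d / 2)) - \<eta> * d) + K / 2 * (\<eta>\<^sup>2 * (s\<^sup>2 * d)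
      + 2 * \<eta> ^ 3 * (s\<^sup>2 * r * (d / 2)) + \<eta> ^ 4 * (w * (2 * K * l W) * (d / 2)))"
    using \<open>K > 0\<close> by (intro add_mono order_refl linear_term mult_left_mono quad) auto
  also have "\<dots> = l W - (\<eta> - (K * s\<^sup>2 + r + K\<^sup>2 * w * l W * \<eta>\<^sup>2 + K * s\<^sup>2 * r * \<eta>) * \<eta>\<^sup>2 / 2) * d"
    by (simp add: field_simps power2_eq_square power3_eq_cube power4_eq_xxxx)
  \<comment> \<open>The collected estimate has coefficients 1 on the last two terms where
    \<open>K_at\<close> has 6 and 3; both terms are nonnegative, so enlarging them only weakens the
    bound.\<close>
  also have "\<dots> \<le> l W - (\<eta> - K_at K l A B \<eta> * \<eta>\<^sup>2 / 2) * d"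
  proof -
    have "0 \<le> K\<^sup>2 * w * l W * \<eta>\<^sup>2" "0 \<le> K * s\<^sup>2 * r * \<eta>"
      using \<open>K > 0\<close> \<open>\<eta> > 0\<close> nonneg w0 g0 gr by simp_all
    then have "K * s\<^sup>2 + r + K\<^sup>2 * w * l W * \<eta>\<^sup>2 + K * s\<^sup>2 * r * \<eta> \<le> K_at K l A B \<eta>"
      unfolding K_at_def loss_def W_def[symmetric] s_def[symmetric] w_def[symmetric] r_def[symmetric]
      by linarith
    then show ?thesis
      using d0 by (intro diff_left_mono mult_right_mono diff_left_mono divide_right_mono) auto
  qed
  finally show ?thesis
    unfolding W'_def W_def d_def loss_def .
qed

theorem theorem3p1:
  fixes l :: "real ^ 'm ^ 'n \<Rightarrow> real"
    and K \<mu> :: real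
    and \<eta> :: "nat \<Rightarrow> real"
    and W1 :: "nat \<Rightarrow> real ^ 'h ^ 'n"
    and W2 :: "nat \<Rightarrow> real ^ 'h ^ 'm"
    and L \<mu>t Kt :: "nat \<Rightarrow> real"
  assumes "twice_differentiable l"
    and "smooth_fun K l"
    and "\<mu> > 0"
    and "strongly_convex \<mu> l"
    and "\<exists>W. l W = 0" and "\<forall>W. l W \<ge> 0"
    and "CARD('h) \<ge> min CARD('n) CARD('m)"
    and "\<forall>t. \<eta> t > 0"
    and "gradient_descent l \<eta> W1 W2"
    and "\<forall>t. L t = loss l (W1 t) (W2 t)"
    and "\<forall>t. \<mu>t t = mu_at \<mu> (W1 t) (W2 t)"
    and "\<forall>t. Kt t = K_at K l (W1 t) (W2 t) (\<eta> t)"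
  shows "\<forall>t. L (Suc t) \<le> L t - (\<eta> t - Kt t * (\<eta> t)\<^sup>2 / 2) * (norm (grad_loss l (W1 t) (W2 t)))\<^sup>2
      \<and> (norm (grad_loss l (W1 t) (W2 t)))\<^sup>2 / 2 \<ge> \<mu>t t * L t
      \<and> (\<eta> t * Kt t < 2 \<longrightarrow>
           L (Suc t) \<le> L t * (1 - 2 * \<mu>t t * \<eta> t + \<mu>t t * Kt t * (\<eta> t)\<^sup>2))"
proof (intro allI)
  fix t
  let ?A = "W1 t" and ?B = "W2 t"
  define G where "G = grad l (?A ** transpose ?B)"
  define D where "D = (norm (grad_loss l ?A ?B))\<^sup>2"
  \<comment> \<open>Inherited from \<open>\<mu> > 0\<close> through
    \<open>\<mu> \<le> K\<close>.\<close>
  have "K > 0"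
    using smooth_ge_strongly_convex[OF assms(2,4)] assms(3) by linarith
  have diff: "l differentiable (at x)" for x
    using assms(1) unfolding twice_differentiable_def by blast
  have D: "D = (norm (T_op ?A ?B G))\<^sup>2"
    by (simp add: D_def G_def grad_loss_eq_T_op[OF diff])
  have "L (Suc t) \<le> loss l ?A ?B - (\<eta> t - K_at K l ?A ?B (\<eta> t) * (\<eta> t)\<^sup>2 / 2) * D"
    using descent_step[OF assms(2) \<open>K > 0\<close> assms(6), of "\<eta> t" ?A ?B] assms(8,9,10)
    unfolding D G_def gradient_descent_def Let_def by simp
  then have 1: "L (Suc t) \<le> L t - (\<eta> t - Kt t * (\<eta> t)\<^sup>2 / 2) * D"
    using assms(10,12) by simp
  have 2: "\<mu>t t * L t \<le> D / 2"
  proof -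
    obtain y where "l y = 0"
      using assms(5) by blast
    then have "2 * \<mu> * L t \<le> (norm G)\<^sup>2"
      using Polyak_Lojasiewicz[OF assms(4,3)] assms(10) unfolding loss_def G_def by simp
    then have "(sigma_min (T_op ?A ?B))\<^sup>2 * (2 * \<mu> * L t) \<le> (sigma_min (T_op ?A ?B))\<^sup>2 * (norm G)\<^sup>2"
      by (intro mult_left_mono) auto
    also have "\<dots> \<le> D"
      unfolding D by (rule norm_ge_sigma_min[OF linear_T_op])
    finally show ?thesis
      using assms(11) by (simp add: mu_at_def mult_ac)
  qed
  have 3: "L (Suc t) \<le> L t * (1 - 2 * \<mu>t t * \<eta> t + \<mu>t t * Kt t * (\<eta> t)\<^sup>2)" if "\<eta> t * Kt t < 2"
  proof -
    \<comment> \<open>The step size condition makes this coefficient nonnegative, so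
      \<open>D\<close> in the descent inequality may be replaced by its lower bound
      \<open>2 * (\<mu>t t * L t)\<close>.\<close>
    have "\<eta> t - Kt t * (\<eta> t)\<^sup>2 / 2 = \<eta> t * (2 - \<eta> t * Kt t) / 2"
      by (simp add: power2_eq_square field_simps)
    also have "\<dots> \<ge> 0"
      using that assms(8) by (simp add: less_imp_le)
    finally have "(\<eta> t - Kt t * (\<eta> t)\<^sup>2 / 2) * (2 * (\<mu>t t * L t)) \<le> (\<eta> t - Kt t * (\<eta> t)\<^sup>2 / 2) * D"
      using 2 by (intro mult_left_mono) auto
    then have "L (Suc t) \<le> L t - (\<eta> t - Kt t * (\<eta> t)\<^sup>2 / 2) * (2 * (\<mu>t t * L t))"
      using 1 by linarith
    also have "\<dots> = L t * (1 - 2 * \<mu>t t * \<eta> t + \<mu>t t * Kt t * (\<eta> t)\<^sup>2)"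
      by (simp add: field_simps)
    finally show ?thesis .
  qed
  show "L (Suc t) \<le> L t - (\<eta> t - Kt t * (\<eta> t)\<^sup>2 / 2) * (norm (grad_loss l ?A ?B))\<^sup>2
      \<and> (norm (grad_loss l ?A ?B))\<^sup>2 / 2 \<ge> \<mu>t t * L t
      \<and> (\<eta> t * Kt t < 2 \<longrightarrow> L (Suc t) \<le> L t * (1 - 2 * \<mu>t t * \<eta> t + \<mu>t t * Kt t * (\<eta> t)\<^sup>2))"
    using 1 2 3 unfolding D_def by blast
qed

end
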